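(* Let $a_1,a_2,b_1,b_2,c_1,c_2,\rho$ be real numbers with $0\le a_1<1$, $0<b_1<1$, $a_2,b_2,c_1,c_2>0$, $\rho>0$, and consider the (implicitly written) piecewise linear discrete time system $$x_t=b_1p_t+(1-b_1)x_{t-1}+b_2y_t,$$ $$y_t=(1-a_1)y_{t-1}-a_2(c_1x_t+c_2y_t-p_t),$$ $$p_t=x_t+\Phi_\rho(p_{t-1}-x_t),\qquad t\in\mathbb N,$$ with initial conditions $(x_0,y_0,p_0)\in\mathbb R^3$ satisfying $|x_0-p_0|\le\rho$. Let $$\mathfrak A=\Big\{(x_*,y_*,p_* )(u):\ x_*(u)=\kappa u,\ y_*(u)=\tfrac{b_1}{b_2}u,\ p_*(u)=(\kappa-1)u,\ |u|\le\rho\Big\},\qquad \kappa=\frac{a_2(b_2+b_1c_2)+a_1b_1}{a_2b_2(1-c_1)},$$ which is the set of equilibrium points of this system. If $c_1>1$, then the line segment $\mathfrak A$ of equilibrium points is the global attractor of the system. Further, any trajectory $(x_t,y_t,p_t)$ converges, as $t\to\infty$, to an equilibrium point $(x_*,y_*,p_* )\in\mathfrak A$.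
   Context: For $\rho>0$, $\Phi_\rho:\mathbb R\to\mathbb R$ is the saturation function: $\Phi_\rho(v)=\rho$ if $v\ge\rho$, $\Phi_\rho(v)=v$ if $-\rho<v<\rho$, $\Phi_\rho(v)=-\rho$ if $v\le-\rho$. The phase space is $\{(x,y,p)\in\mathbb R^3:|x-p|\le\rho\}$. When $c_1>1$, the implicit system defines an explicit piecewise linear map $(x_t,y_t,p_t)=f(x_{t-1},y_{t-1},p_{t-1})$ on this phase space; trajectories are orbits of $f$ and "global attractor" is meant for the discrete dynamical system generated by $f$ on this phase space. *)

theory Defs
  imports "HOL-Analysis.Analysis"
begin

definition saturation :: "real \<Rightarrow> real \<Rightarrow> real" where
  "saturation \<rho> v = (if v \<ge> \<rho> then \<rho> else if - \<rho> < v then v else - \<rho>)"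

definition phase_space :: "real \<Rightarrow> (real \<times> real \<times> real) set" where
  "phase_space \<rho> = {(x, y, p). \<bar>x - p\<bar> \<le> \<rho>}"

text \<open>
  The implicit system as a relation between the state at time \<open>t - 1\<close> (first triple)
  and the state at time \<open>t\<close> (second triple).
\<close>
definition system_step ::
  "real \<Rightarrow> real \<Rightarrow> real \<Rightarrow> real \<Rightarrow> real \<Rightarrow> real \<Rightarrow> real \<Rightarrow>
   real \<times> real \<times> real \<Rightarrow> real \<times> real \<times> real \<Rightarrow> bool" where
  "system_step a1 a2 b1 b2 c1 c2 \<rho> = (\<lambda>(x, y, p) (x', y', p').
     x' = b1 * p' + (1 - b1) * x + b2 * y' \<and>
     y' = (1 - a1) * y - a2 * (c1 * x' + c2 * y' - p') \<and>
     p' = x' + saturation \<rho> (p - x'))"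

text \<open>
  The explicit map \<open>f\<close>. It is only meaningful when the implicit system is uniquely solvable,
  which is the case for \<open>c1 > 1\<close>; see \<open>system_step_unique_solution\<close> below.
\<close>
definition system_map ::
  "real \<Rightarrow> real \<Rightarrow> real \<Rightarrow> real \<Rightarrow> real \<Rightarrow> real \<Rightarrow> real \<Rightarrow>
   real \<times> real \<times> real \<Rightarrow> real \<times> real \<times> real" where
  "system_map a1 a2 b1 b2 c1 c2 \<rho> s = (THE s'. system_step a1 a2 b1 b2 c1 c2 \<rho> s s')"

definition is_trajectory ::
  "real \<Rightarrow> real \<Rightarrow> real \<Rightarrow> real \<Rightarrow> real \<Rightarrow> real \<Rightarrow> real \<Rightarrow>
   (nat \<Rightarrow> real \<times> real \<times> real) \<Rightarrow> bool" where
  "is_trajectory a1 a2 b1 b2 c1 c2 \<rho> s \<longleftrightarrow>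
     s 0 \<in> phase_space \<rho> \<and> (\<forall>t. system_step a1 a2 b1 b2 c1 c2 \<rho> (s t) (s (Suc t)))"

definition equilibria ::
  "real \<Rightarrow> real \<Rightarrow> real \<Rightarrow> real \<Rightarrow> real \<Rightarrow> real \<Rightarrow> real \<Rightarrow>
   (real \<times> real \<times> real) set" where
  "equilibria a1 a2 b1 b2 c1 c2 \<rho> =
     {s \<in> phase_space \<rho>. system_step a1 a2 b1 b2 c1 c2 \<rho> s s}"

definition kappa :: "real \<Rightarrow> real \<Rightarrow> real \<Rightarrow> real \<Rightarrow> real \<Rightarrow> real \<Rightarrow> real" where
  "kappa a1 a2 b1 b2 c1 c2 = (a2 * (b2 + b1 * c2) + a1 * b1) / (a2 * b2 * (1 - c1))"

definition equilibrium_segment ::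
  "real \<Rightarrow> real \<Rightarrow> real \<Rightarrow> real \<Rightarrow> real \<Rightarrow> real \<Rightarrow> real \<Rightarrow>
   (real \<times> real \<times> real) set" where
  "equilibrium_segment a1 a2 b1 b2 c1 c2 \<rho> =
     (let \<kappa> = kappa a1 a2 b1 b2 c1 c2
      in {(\<kappa> * u, b1 / b2 * u, (\<kappa> - 1) * u) | u. \<bar>u\<bar> \<le> \<rho>})"

text \<open>
  \<open>A\<close> is the global attractor of the discrete dynamical system generated by \<open>f\<close> on \<open>X\<close>:
  a nonempty compact set, (strictly) invariant, which attracts every bounded subset of \<open>X\<close>
  uniformly. Such a set is unique and contains every bounded \<open>B \<subseteq> X\<close> with \<open>f ` B = B\<close>.
\<close>
definition global_attractor ::
  "('a::metric_space \<Rightarrow> 'a) \<Rightarrow> 'a set \<Rightarrow> 'a set \<Rightarrow> bool" where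
  "global_attractor f X A \<longleftrightarrow>
     f ` X \<subseteq> X \<and> A \<noteq> {} \<and> A \<subseteq> X \<and> compact A \<and> f ` A = A \<and>
     (\<forall>B. B \<subseteq> X \<and> bounded B \<longrightarrow>
        (\<forall>\<epsilon>>0. \<exists>N. \<forall>n\<ge>N. \<forall>s\<in>B. \<exists>a\<in>A. dist ((f ^^ n) s) a < \<epsilon>))"

lemma saturation_eq: "\<rho> > 0 \<Longrightarrow> saturation \<rho> v = max (- \<rho>) (min \<rho> v)"
  by (auto simp: saturation_def)

lemma system_step_unique_solution:
  assumes "0 < b1" "b1 < 1" "a2 > 0" "b2 > 0" "c2 > 0" "\<rho> > 0" "c1 > 1"
  shows "\<exists>!s'. system_step a1 a2 b1 b2 c1 c2 \<rho> s s'"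
proof -
  obtain x y p where s: "s = (x, y, p)" by (cases s) auto
  define D where "D = 1 + a2 * c2"
  have D: "D > 0" using assms by (simp add: D_def add_pos_pos)
  define \<beta> where "\<beta> = b1 * D + a2 * b2"
  define m where "m = (1 - b1) * D + a2 * b2 * (c1 - 1)"
  define r where "r = (1 - b1) * D * x + b2 * (1 - a1) * y"
  define g where "g z = m * z - \<beta> * saturation \<rho> (p - z)" for z
  define Y where "Y z = ((1 - a1) * y - a2 * (c1 * z - (z + saturation \<rho> (p - z)))) / D" for z
  have \<beta>: "\<beta> > 0" using assms D by (simp add: \<beta>_def add_pos_pos)
  have m: "m > 0" using assms D by (simp add: m_def add_pos_pos)
  have step_iff: "system_step a1 a2 b1 b2 c1 c2 \<rho> s (x', y', p') \<longleftrightarrow>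
      g x' = r \<and> y' = Y x' \<and> p' = x' + saturation \<rho> (p - x')" for x' y' p'
  proof -
    define \<sigma> where "\<sigma> = saturation \<rho> (p - x')"
    have 1: "y' = (1 - a1) * y - a2 * (c1 * x' + c2 * y' - (x' + \<sigma>)) \<longleftrightarrow> y' = Y x'"
      using D by (simp add: Y_def \<sigma>_def[symmetric] field_simps) (auto simp: D_def algebra_simps)
    have 2: "x' = b1 * (x' + \<sigma>) + (1 - b1) * x + b2 * Y x' \<longleftrightarrow> g x' = r"
    proof -
      have "x' = b1 * (x' + \<sigma>) + (1 - b1) * x + b2 * Y x' \<longleftrightarrow>
            D * x' = D * (b1 * (x' + \<sigma>) + (1 - b1) * x + b2 * Y x')" using D by simp
      also have "D * (b1 * (x' + \<sigma>) + (1 - b1) * x + b2 * Y x') =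
            D * (b1 * (x' + \<sigma>) + (1 - b1) * x) + b2 * (D * Y x')" by (simp add: algebra_simps)
      also have "D * Y x' = (1 - a1) * y - a2 * (c1 * x' - (x' + \<sigma>))"
        using D by (simp add: Y_def \<sigma>_def[symmetric])
      finally show ?thesis
        by (auto simp: g_def r_def m_def \<beta>_def \<sigma>_def[symmetric] algebra_simps)
    qed
    show ?thesis
      unfolding system_step_def s prod.case \<sigma>_def[symmetric] using 1 2 by auto
  qed
  have "strict_mono g"
  proof (rule strict_monoI)
    fix z w :: real assume "z < w"
    then have "m * z < m * w" using m by simp
    moreover have "saturation \<rho> (p - w) \<le> saturation \<rho> (p - z)"
      using \<open>z < w\<close> assms(6) by (auto simp: saturation_eq)
    then have "\<beta> * saturation \<rho> (p - w) \<le> \<beta> * saturation \<rho> (p - z)" using \<beta> by simp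
    ultimately show "g z < g w" by (simp add: g_def)
  qed
  moreover have "\<exists>z. g z = r"
  proof -
    define h where "h = \<beta> * \<rho>"
    have h: "h \<ge> 0" using \<beta> assms by (simp add: h_def)
    have b: "- h \<le> \<beta> * saturation \<rho> v \<and> \<beta> * saturation \<rho> v \<le> h" for v
    proof -
      have "- \<rho> \<le> saturation \<rho> v" "saturation \<rho> v \<le> \<rho>" using assms(6) by (auto simp: saturation_eq)
      then have "\<beta> * (- \<rho>) \<le> \<beta> * saturation \<rho> v" "\<beta> * saturation \<rho> v \<le> \<beta> * \<rho>"
        using \<beta> by (meson mult_left_mono less_imp_le)+
      then show ?thesis by (simp add: h_def)
    qed
    have "g ((r - h) / m) \<le> r" "r \<le> g ((r + h) / m)"
      using m b[of "p - (r - h) / m"] b[of "p - (r + h) / m"] by (auto simp: g_def)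
    moreover have "(r - h) / m \<le> (r + h) / m" using h m by (simp add: divide_right_mono)
    moreover have "continuous_on {(r - h) / m..(r + h) / m} g"
      unfolding g_def saturation_eq[OF assms(6)] by (intro continuous_intros)
    ultimately show ?thesis using IVT'[of g] by blast
  qed
  ultimately obtain z where z: "g z = r" and uniq: "\<And>w. g w = r \<Longrightarrow> w = z"
    by (metis strict_mono_eq)
  show ?thesis
  proof (rule ex1I[of _ "(z, Y z, z + saturation \<rho> (p - z))"])
    show "system_step a1 a2 b1 b2 c1 c2 \<rho> s (z, Y z, z + saturation \<rho> (p - z))"
      using z by (simp add: step_iff)
    fix s' assume *: "system_step a1 a2 b1 b2 c1 c2 \<rho> s s'"
    then show "s' = (z, Y z, z + saturation \<rho> (p - z))"
      by (cases s') (auto simp: step_iff dest: uniq[OF sym])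
  qed
qed

lemma system_map_eq_iff:
  assumes "0 < b1" "b1 < 1" "a2 > 0" "b2 > 0" "c2 > 0" "\<rho> > 0" "c1 > 1"
  shows "system_map a1 a2 b1 b2 c1 c2 \<rho> s = s' \<longleftrightarrow> system_step a1 a2 b1 b2 c1 c2 \<rho> s s'"
  unfolding system_map_def
  using theI'[OF system_step_unique_solution[OF assms]] the1_equality[OF system_step_unique_solution[OF assms]]
  by metis

lemma is_trajectory_iff_orbit:
  assumes "0 < b1" "b1 < 1" "a2 > 0" "b2 > 0" "c2 > 0" "\<rho> > 0" "c1 > 1"
  shows "is_trajectory a1 a2 b1 b2 c1 c2 \<rho> s \<longleftrightarrow>
    s 0 \<in> phase_space \<rho> \<and> (\<forall>t. s t = (system_map a1 a2 b1 b2 c1 c2 \<rho> ^^ t) (s 0))"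
proof -
  have "(\<forall>t. system_map a1 a2 b1 b2 c1 c2 \<rho> (s t) = s (Suc t)) \<longleftrightarrow>
        (\<forall>t. s t = (system_map a1 a2 b1 b2 c1 c2 \<rho> ^^ t) (s 0))" (is "?L \<longleftrightarrow> ?R")
  proof
    assume L: ?L
    show ?R
    proof
      fix t show "s t = (system_map a1 a2 b1 b2 c1 c2 \<rho> ^^ t) (s 0)"
        by (induction t) (simp_all flip: L[rule_format])
    qed
  next
    assume R: ?R
    show ?L
    proof
      fix t
      show "system_map a1 a2 b1 b2 c1 c2 \<rho> (s t) = s (Suc t)"
        using R[rule_format, of t] R[rule_format, of "Suc t"] by simp
    qed
  qed
  then show ?thesis by (simp add: is_trajectory_def system_map_eq_iff[OF assms])
qed

end

theory Submission
  imports Defs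
begin

text \<open>
  Put \<open>u = x - p\<close> and \<open>w = (b\<^sub>2 y - b\<^sub>1 u) / (1 - b\<^sub>1)\<close>. Then \<open>w' = x' - x\<close>, \<open>u' = \<Phi>\<^sub>\<rho>(u + w')\<close>, and
  the second equation becomes \<open>A (w' - w) + B (u' - u) + C w' + D u' + E x' = 0\<close> with
  \<open>A, B, C, D, E > 0\<close> and \<open>\<kappa> = - D / E\<close>. Since \<open>\<Phi>\<^sub>\<rho>\<close> is the projection onto \<open>[-\<rho>, \<rho>]\<close>,
  multiplying this equation by \<open>2 w'\<close> shows that for \<^emph>\<open>every\<close> equilibrium, with parameter \<open>v\<close>, the
  quadratic energy \<open>A w\<^sup>2 + E (x - \<kappa> v)\<^sup>2 + D (u - v)\<^sup>2\<close> drops in each step by at least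
  \<open>A (w' - w)\<^sup>2 + 2 C w'\<^sup>2\<close>. The drops are summable, so within a number of steps that depends only
  on the initial energy one of them is small. At such a time the energy with respect to the equilibrium
  with parameter \<open>u'\<close> is small, and by monotonicity it stays small.
  This gives uniform attraction, and it makes every trajectory a Cauchy sequence.
\<close>

section \<open>Saturation as the projection onto an interval\<close>

lemma saturation_abs_le: "\<rho> > 0 \<Longrightarrow> \<bar>saturation \<rho> v\<bar> \<le> \<rho>"
  by (auto simp: saturation_def)

lemma saturation_fixed_iff: "\<rho> > 0 \<Longrightarrow> saturation \<rho> v = v \<longleftrightarrow> \<bar>v\<bar> \<le> \<rho>"
  by (auto simp: saturation_def)

lemma saturation_minus: "\<rho> > 0 \<Longrightarrow> saturation \<rho> (- v) = - saturation \<rho> v"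
  by (auto simp: saturation_def)

lemma saturation_increment_abs_le:
  "\<rho> > 0 \<Longrightarrow> \<bar>u\<bar> \<le> \<rho> \<Longrightarrow> \<bar>saturation \<rho> (u + w) - u\<bar> \<le> \<bar>w\<bar>"
  by (auto simp: saturation_def)

lemma saturation_increment_mult_nonneg:
  "\<rho> > 0 \<Longrightarrow> \<bar>u\<bar> \<le> \<rho> \<Longrightarrow> (saturation \<rho> (u + w) - u) * w \<ge> 0"
  by (auto simp: saturation_def zero_le_mult_iff)

text \<open>This is the obtuse angle property of the nearest point in a convex set.\<close>

lemma saturation_variational_inequality:
  "\<rho> > 0 \<Longrightarrow> \<bar>v\<bar> \<le> \<rho> \<Longrightarrow> (z - saturation \<rho> z) * (saturation \<rho> z - v) \<ge> 0"
  by (auto simp: saturation_def zero_le_mult_iff)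

lemma stop_energy_step:
  fixes A B C D E :: real
  assumes "\<rho> > 0" "\<bar>u\<bar> \<le> \<rho>" "\<bar>v\<bar> \<le> \<rho>" "B \<ge> 0" "D \<ge> 0" "E \<ge> 0"
    and u': "u' = saturation \<rho> (u + w')"
    and balance: "A * (w' - w) + B * (u' - u) + C * w' + D * u' + E * (x + w') = 0"
    and v: "E * m = - D * v"
  shows "A * w'\<^sup>2 + E * (x + w' - m)\<^sup>2 + D * (u' - v)\<^sup>2 + (A * (w' - w)\<^sup>2 + 2 * C * w'\<^sup>2)
    \<le> A * w\<^sup>2 + E * (x - m)\<^sup>2 + D * (u - v)\<^sup>2"
proof -
  \<comment> \<open>Writing \<open>w' = (u + w' - u') + (u' - u)\<close> splits the \<open>D\<close>
    term of the product below into a nonnegative part and a difference of squares plus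
    \<open>(u' - u)^2\<close>. The four quantities here are all that the estimate discards.\<close>
  have "B * ((u' - u) * w') \<ge> 0" "D * ((u + w' - u') * (u' - v)) \<ge> 0" "D * (u' - u)\<^sup>2 \<ge> 0" "E * w'\<^sup>2 \<ge> 0"
    using saturation_increment_mult_nonneg[of \<rho> u w'] saturation_variational_inequality[of \<rho> v "u + w'"] assms
    by simp_all
  \<comment> \<open>Since \<open>E * m + D * v = 0\<close>, the balance can be centred at
    \<open>m\<close> and \<open>v\<close>. Then
    \<open>2 * a * (a - b) = a^2 - b^2 + (a - b)^2\<close> produces the energy differences.\<close>
  moreover have "2 * w' * (A * (w' - w) + B * (u' - u) + C * w' + D * (u' - v) + E * (x + w' - m)) = 0"
    using balance v by (simp add: algebra_simps)
  ultimately show ?thesis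
    by (simp add: power2_eq_square algebra_simps)
qed

section \<open>Two facts about sequences\<close>

lemma sum_le_imp_exists_small_term:
  fixes r :: "nat \<Rightarrow> real"
  assumes "(\<Sum>k<N. r k) \<le> M" "N > 0"
  shows "\<exists>k<N. r k \<le> M / real N"
proof (rule ccontr)
  assume "\<not> ?thesis"
  then have "(\<Sum>k<N. M / real N) < (\<Sum>k<N. r k)"
    using assms(2) by (intro sum_strict_mono) auto
  then show False
    using assms by simp
qed

text \<open>The point \<open>a\<close> may change with \<open>\<epsilon>\<close>, but it serves all
  late times at once, which makes \<open>s\<close> Cauchy. Completeness then gives a limit, and
  closedness puts it into \<open>A\<close>.\<close>

lemma convergent_if_eventually_near:
  fixes s :: "nat \<Rightarrow> 'a::complete_space"
  assumes "closed A"
    and near: "\<And>\<epsilon>. \<epsilon> > 0 \<Longrightarrow> \<exists>N. \<exists>a\<in>A. \<forall>n\<ge>N. dist (s n) a < \<epsilon>"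
  shows "\<exists>a\<in>A. s \<longlonglongrightarrow> a"
proof -
  have "Cauchy s"
  proof (rule metric_CauchyI)
    fix e :: real assume "0 < e"
    then obtain N a where "\<forall>n\<ge>N. dist (s n) a < e / 2"
      using near[of "e / 2"] by auto
    then show "\<exists>M. \<forall>m\<ge>M. \<forall>n\<ge>M. dist (s m) (s n) < e"
      by (meson dist_triangle_half_l)
  qed
  then obtain l where l: "s \<longlonglongrightarrow> l"
    using Cauchy_convergent_iff convergent_def by blast
  have "\<exists>a\<in>A. dist a l < e" if "e > 0" for e
  proof -
    obtain N a where "a \<in> A" "\<forall>n\<ge>N. dist (s n) a < e / 2"
      using near[of "e / 2"] \<open>e > 0\<close> by auto
    moreover have "(\<lambda>n. dist (s n) a) \<longlonglongrightarrow> dist l a"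
      by (intro tendsto_intros l)
    ultimately have "dist l a \<le> e / 2"
      by (intro LIMSEQ_le_const2) (auto intro!: exI[of _ N] less_imp_le)
    then show ?thesis
      using \<open>a \<in> A\<close> \<open>e > 0\<close> by (auto simp: dist_commute intro!: bexI[of _ a])
  qed
  then have "l \<in> A"
    using assms(1) closed_approachable by blast
  then show ?thesis
    using l by blast
qed

section \<open>The segment as the set of equilibria\<close>

lemma equilibrium_segment_eq_image:
  "equilibrium_segment a1 a2 b1 b2 c1 c2 \<rho> =
    (\<lambda>u. (kappa a1 a2 b1 b2 c1 c2 * u, b1 / b2 * u, (kappa a1 a2 b1 b2 c1 c2 - 1) * u)) ` {-\<rho>..\<rho>}"
  by (auto simp: equilibrium_segment_def Let_def abs_le_iff image_iff)

lemma compact_equilibrium_segment: "compact (equilibrium_segment a1 a2 b1 b2 c1 c2 \<rho>)"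
  unfolding equilibrium_segment_eq_image
  by (intro compact_continuous_image continuous_intros compact_Icc)

text \<open>At a fixed point the saturation only demands a bound on \<open>x - p\<close>, and the
  other two equations are linear. Eliminating \<open>y\<close> leaves \<open>x\<close> with the
  nonzero factor \<open>a2 * b2 * (1 - c1)\<close>. The parameter of the segment is recovered as
  \<open>u = x - p\<close>.\<close>

lemma equilibria_eq_segment:
  assumes "a2 > 0" "b2 > 0" "c1 \<noteq> 1" "\<rho> > 0"
  shows "equilibria a1 a2 b1 b2 c1 c2 \<rho> = equilibrium_segment a1 a2 b1 b2 c1 c2 \<rho>"
proof -
  define \<kappa> where "\<kappa> = kappa a1 a2 b1 b2 c1 c2"
  have \<kappa>: "a2 * b2 * (1 - c1) * \<kappa> = a2 * (b2 + b1 * c2) + a1 * b1"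
    using assms by (simp add: \<kappa>_def kappa_def)
  have "(x, y, p) \<in> equilibria a1 a2 b1 b2 c1 c2 \<rho> \<longleftrightarrow>
    x = \<kappa> * (x - p) \<and> y = b1 / b2 * (x - p) \<and> \<bar>x - p\<bar> \<le> \<rho>" for x y p
  proof -
    have "(x, y, p) \<in> equilibria a1 a2 b1 b2 c1 c2 \<rho> \<longleftrightarrow>
      \<bar>x - p\<bar> \<le> \<rho> \<and> b2 * y = b1 * (x - p) \<and> a1 * y + a2 * (c1 * x + c2 * y - p) = 0"
      using saturation_fixed_iff[OF \<open>\<rho> > 0\<close>, of "p - x"]
      by (auto simp: equilibria_def phase_space_def system_step_def abs_minus_commute algebra_simps)
    \<comment> \<open>The factor \<open>b2\<close> lets \<open>y\<close> be eliminated through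
      \<open>b2 * y = b1 * (x - p)\<close> without division.\<close>
    also have "\<dots> \<longleftrightarrow> \<bar>x - p\<bar> \<le> \<rho> \<and> b2 * y = b1 * (x - p) \<and>
        b2 * (a1 * y + a2 * (c1 * x + c2 * y - p)) = 0"
      using assms by simp
    also have "\<dots> \<longleftrightarrow> \<bar>x - p\<bar> \<le> \<rho> \<and> b2 * y = b1 * (x - p) \<and>
        a2 * b2 * (1 - c1) * x = a2 * b2 * (1 - c1) * (\<kappa> * (x - p))"
    proof (intro conj_cong refl)
      assume "b2 * y = b1 * (x - p)"
      then have "b2 * (a1 * y + a2 * (c1 * x + c2 * y - p)) =
          (a1 + a2 * c2) * (b1 * (x - p)) + a2 * b2 * (c1 * x - p)"
        by algebra
      then show "b2 * (a1 * y + a2 * (c1 * x + c2 * y - p)) = 0 \<longleftrightarrow>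
          a2 * b2 * (1 - c1) * x = a2 * b2 * (1 - c1) * (\<kappa> * (x - p))"
        unfolding mult.assoc[symmetric, of _ \<kappa>] \<kappa> by (auto simp: algebra_simps)
    qed
    also have "\<dots> \<longleftrightarrow> x = \<kappa> * (x - p) \<and> y = b1 / b2 * (x - p) \<and> \<bar>x - p\<bar> \<le> \<rho>"
    proof -
      have "a2 * b2 * (1 - c1) \<noteq> 0"
        using assms by simp
      moreover have "b2 * y = b1 * (x - p) \<longleftrightarrow> y = b1 / b2 * (x - p)"
        using assms by (auto simp: field_simps)
      ultimately show ?thesis
        unfolding mult_left_cancel[OF \<open>a2 * b2 * (1 - c1) \<noteq> 0\<close>] by blast
    qed
    finally show ?thesis .
  qed
  moreover have "(x, y, p) \<in> equilibrium_segment a1 a2 b1 b2 c1 c2 \<rho> \<longleftrightarrow>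
    x = \<kappa> * (x - p) \<and> y = b1 / b2 * (x - p) \<and> \<bar>x - p\<bar> \<le> \<rho>" (is "_ \<longleftrightarrow> ?R") for x y p
  proof
    assume "(x, y, p) \<in> equilibrium_segment a1 a2 b1 b2 c1 c2 \<rho>"
    then obtain u where u: "x = \<kappa> * u" "y = b1 / b2 * u" "p = (\<kappa> - 1) * u" "\<bar>u\<bar> \<le> \<rho>"
      by (auto simp: equilibrium_segment_def Let_def \<kappa>_def)
    then have "x - p = u"
      by (simp add: algebra_simps)
    then show ?R
      using u by simp
  next
    assume ?R
    moreover from this have "p = (\<kappa> - 1) * (x - p)"
      by (simp add: algebra_simps)
    ultimately show "(x, y, p) \<in> equilibrium_segment a1 a2 b1 b2 c1 c2 \<rho>"
      unfolding equilibrium_segment_def Let_def \<kappa>_def[symmetric] by blast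
  qed
  ultimately show ?thesis
    by (simp add: set_eq_iff split_paired_All)
qed

section \<open>The system for \<open>c1 > 1\<close> in reduced coordinates\<close>

locale piecewise_linear_system =
  fixes a1 a2 b1 b2 c1 c2 \<rho> :: real
  assumes a1: "0 \<le> a1" "a1 < 1" and b1: "0 < b1" "b1 < 1"
    and a2: "a2 > 0" and b2: "b2 > 0" and c1: "c1 > 1" and c2: "c2 > 0" and \<rho>: "\<rho> > 0"
begin

abbreviation f where "f \<equiv> system_map a1 a2 b1 b2 c1 c2 \<rho>"

text \<open>\<open>A\<close> to \<open>E\<close> are the coefficients that arise when
  \<open>b2\<close> times the second equation is expressed through \<open>x\<close>,
  \<open>gap\<close> and \<open>velocity\<close>.\<close>

definition "A = (1 - a1) * (1 - b1)"
definition "B = (1 - a1) * b1"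
definition "C = (a1 + a2 * c2) * (1 - b1)"
definition "D = (a1 + a2 * c2) * b1 + a2 * b2"
definition "E = a2 * b2 * (c1 - 1)"

lemma pos: "A > 0" "B > 0" "C > 0" "D > 0" "E > 0"
proof -
  have "a1 + a2 * c2 > 0"
    using a1 a2 c2 by (intro add_nonneg_pos mult_pos_pos) auto
  then show "A > 0" "B > 0" "C > 0" "D > 0" "E > 0"
    using a1 b1 a2 b2 c1
    by (auto simp: A_def B_def C_def D_def E_def intro!: mult_pos_pos add_pos_pos)
qed

abbreviation \<kappa> where "\<kappa> \<equiv> kappa a1 a2 b1 b2 c1 c2"

text \<open>Hence \<open>D * u + E * x\<close> vanishes at every equilibrium, so the balance
  equation can be centred at any of them.\<close>

lemma kappa_eq: "E * \<kappa> = - D"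
proof -
  have "\<kappa> = D / (- E)"
    by (simp add: kappa_def D_def E_def algebra_simps)
  then show ?thesis
    using pos by simp
qed

definition equilibrium :: "real \<Rightarrow> real \<times> real \<times> real" where
  "equilibrium v = (\<kappa> * v, b1 / b2 * v, (\<kappa> - 1) * v)"

lemma equilibrium_in_segment:
  "\<bar>v\<bar> \<le> \<rho> \<Longrightarrow> equilibrium v \<in> equilibrium_segment a1 a2 b1 b2 c1 c2 \<rho>"
  by (auto simp: equilibrium_def equilibrium_segment_def Let_def)

text \<open>For a state that is not initial, this is the last increment of \<open>x\<close>; see \<open>step_reduced\<close>.\<close>
definition velocity :: "real \<times> real \<times> real \<Rightarrow> real" where
  "velocity = (\<lambda>(x, y, p). (b2 * y - b1 * (x - p)) / (1 - b1))"

definition gap :: "real \<times> real \<times> real \<Rightarrow> real" where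
  "gap = (\<lambda>(x, y, p). x - p)"

text \<open>The equilibrium with parameter \<open>v\<close> has velocity \<open>0\<close>, first
  coordinate \<open>\<kappa> * v\<close> and gap \<open>v\<close>, so this is a weighted squared
  distance to it in the reduced coordinates.\<close>

definition energy :: "real \<Rightarrow> real \<times> real \<times> real \<Rightarrow> real" where
  "energy v s = A * (velocity s)\<^sup>2 + E * (fst s - \<kappa> * v)\<^sup>2 + D * (gap s - v)\<^sup>2"

definition energy_drop :: "real \<times> real \<times> real \<Rightarrow> real" where
  "energy_drop s = A * (velocity (f s) - velocity s)\<^sup>2 + 2 * C * (velocity (f s))\<^sup>2"

lemma in_phase_space_iff: "s \<in> phase_space \<rho> \<longleftrightarrow> \<bar>gap s\<bar> \<le> \<rho>"
  by (cases s) (simp add: phase_space_def gap_def)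

lemma map_eq_iff: "f s = s' \<longleftrightarrow> system_step a1 a2 b1 b2 c1 c2 \<rho> s s'"
  using a1 b1 a2 b2 c1 c2 \<rho> by (intro system_map_eq_iff) auto

text \<open>The three claims are the three equations of the system: the first solved for
  \<open>x' - x\<close>, the third with its sign reversed, and the second times \<open>b2\<close>
  with \<open>y\<close> and \<open>y'\<close> eliminated.\<close>

lemma step_reduced:
  "fst (f s) = fst s + velocity (f s)"
  "gap (f s) = saturation \<rho> (gap s + velocity (f s))"
  "A * (velocity (f s) - velocity s) + B * (gap (f s) - gap s) + C * velocity (f s)
    + D * gap (f s) + E * (fst s + velocity (f s)) = 0"
proof -
  obtain x y p where s: "s = (x, y, p)" by (cases s) auto
  obtain x' y' p' where s': "f s = (x', y', p')" by (cases "f s") auto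
  have step: "x' = b1 * p' + (1 - b1) * x + b2 * y'"
    "y' = (1 - a1) * y - a2 * (c1 * x' + c2 * y' - p')" "p' = x' + saturation \<rho> (p - x')"
    using s' unfolding map_eq_iff unfolding s system_step_def prod.case by blast+
  define w where "w = velocity s"
  define w' where "w' = velocity (f s)"
  have w: "(1 - b1) * w = b2 * y - b1 * (x - p)" and w': "(1 - b1) * w' = b2 * y' - b1 * (x' - p')"
    using b1 unfolding w_def w'_def s' unfolding s velocity_def by simp_all
  have "(1 - b1) * w' = (1 - b1) * (x' - x)"
    unfolding w' using step(1) by (simp add: algebra_simps)
  then have x': "x' = x + w'"
    using b1 by simp
  \<comment> \<open>Oddness of the saturation passes from \<open>p - x\<close> to the gap
    \<open>x - p\<close>.\<close>
  have "x' - p' = - saturation \<rho> (- (x' - p))"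
    using step(3) by simp
  then have u': "x' - p' = saturation \<rho> (x - p + w')"
    unfolding saturation_minus[OF \<rho>] by (simp add: x' algebra_simps)
  have y: "b2 * y = (1 - b1) * w + b1 * (x - p)" and y': "b2 * y' = (1 - b1) * w' + b1 * (x' - p')"
    using w w' by simp_all
  have "b2 * (y' - (1 - a1) * y + a2 * (c1 * x' + c2 * y' - p')) = 0"
    unfolding mult_eq_0_iff using step(2) by linarith
  then have "(1 + a2 * c2) * (b2 * y') - (1 - a1) * (b2 * y) + a2 * b2 * (c1 * x' - p') = 0"
    by (simp add: algebra_simps)
  \<comment> \<open>Splitting \<open>1 + a2 * c2\<close> into
    \<open>(1 - a1) + (a1 + a2 * c2)\<close> separates the increments, with \<open>A\<close> and
    \<open>B\<close>, from the terms at the new time.\<close>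
  then have balance: "A * (w' - w) + B * ((x' - p') - (x - p)) + C * w' + D * (x' - p') + E * x' = 0"
    unfolding y y' A_def B_def C_def D_def E_def by (simp add: algebra_simps)
  have g: "gap s = x - p" "gap (f s) = x' - p'" "fst s = x" "fst (f s) = x'"
    unfolding s' unfolding s gap_def by simp_all
  show "fst (f s) = fst s + velocity (f s)"
    "gap (f s) = saturation \<rho> (gap s + velocity (f s))"
    "A * (velocity (f s) - velocity s) + B * (gap (f s) - gap s) + C * velocity (f s)
      + D * gap (f s) + E * (fst s + velocity (f s)) = 0"
    unfolding w_def[symmetric] w'_def[symmetric] g using u' balance by (simp_all only: x')
qed

section \<open>Decay of the energy along orbits\<close>

lemma map_in_phase_space: "f s \<in> phase_space \<rho>"
  using saturation_abs_le[OF \<rho>] by (simp add: in_phase_space_iff step_reduced(2))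

lemma orbit_in_phase_space: "s \<in> phase_space \<rho> \<Longrightarrow> (f ^^ n) s \<in> phase_space \<rho>"
  by (induction n) (simp_all add: map_in_phase_space)

lemma energy_step:
  assumes "s \<in> phase_space \<rho>" "\<bar>v\<bar> \<le> \<rho>"
  shows "energy v (f s) + energy_drop s \<le> energy v s"
proof -
  have "E * (\<kappa> * v) = - D * v"
    using kappa_eq by (simp flip: mult.assoc)
  then show ?thesis
    unfolding energy_def energy_drop_def step_reduced(1)[of s]
    using assms pos \<rho>
    by (intro stop_energy_step[OF \<rho> _ _ _ _ _ step_reduced(2,3)]) (auto simp: in_phase_space_iff)
qed

lemma energy_nonneg: "energy v s \<ge> 0"
  using pos by (simp add: energy_def)

lemma energy_drop_nonneg: "energy_drop s \<ge> 0"
  using pos by (simp add: energy_drop_def)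

lemma energy_antimono:
  assumes "s \<in> phase_space \<rho>" "\<bar>v\<bar> \<le> \<rho>" "m \<le> n"
  shows "energy v ((f ^^ n) s) \<le> energy v ((f ^^ m) s)"
  using \<open>m \<le> n\<close>
proof (induction rule: dec_induct)
  case (step n)
  then show ?case
    using energy_step[OF orbit_in_phase_space[OF assms(1)] assms(2), of n] energy_drop_nonneg[of "(f ^^ n) s"]
    by simp
qed simp

lemma sum_energy_drop_le:
  assumes "s \<in> phase_space \<rho>" "\<bar>v\<bar> \<le> \<rho>"
  shows "(\<Sum>k<n. energy_drop ((f ^^ k) s)) \<le> energy v s"
proof -
  have "(\<Sum>k<n. energy_drop ((f ^^ k) s)) + energy v ((f ^^ n) s) \<le> energy v s"
  proof (induction n)
    case (Suc n)
    then show ?case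
      using energy_step[OF orbit_in_phase_space[OF assms(1)] assms(2), of n] by simp
  qed simp
  then show ?thesis
    using energy_nonneg[of v "(f ^^ n) s"] by simp
qed

section \<open>Comparison of the energy with its drop, with distance and with bounded sets\<close>

text \<open>Choosing the gap of \<open>f s\<close> as parameter removes the gap term. The balance
  equation expresses the remaining deviation in \<open>x\<close> through the velocities and the gap
  increment, and the latter is at most the new velocity in absolute value.\<close>

lemma energy_gap_le_drop:
  "\<exists>K>0. \<forall>s\<in>phase_space \<rho>. energy (gap (f s)) (f s) \<le> K * energy_drop s"
proof -
  \<comment> \<open>\<open>L\<close> collects the coefficients of \<open>w'^2\<close> below, divided
    by its weight \<open>2 * C\<close> in the drop. The \<open>3\<close> comes from bounding the
    square of a sum of three terms.\<close>
  define L where "L = A / (2 * C) + 3 * (B\<^sup>2 + C\<^sup>2) / (2 * C * E)"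
  have L: "L > 0"
    using pos unfolding L_def by (intro add_pos_pos divide_pos_pos mult_pos_pos) auto
  have "energy (gap (f s)) (f s) \<le> (3 * A / E + L) * energy_drop s" if "s \<in> phase_space \<rho>" for s
  proof -
    define w where "w = velocity s"
    define w' where "w' = velocity (f s)"
    define h where "h = gap (f s) - gap s"
    define z where "z = E * (fst (f s) - \<kappa> * gap (f s))"
    have "z = E * (fst s + w') + D * gap (f s)"
      unfolding z_def step_reduced(1)[of s] w'_def[symmetric] using kappa_eq by algebra
    then have z: "z = - (A * (w' - w) + B * h + C * w')"
      using step_reduced(3)[of s] unfolding w_def[symmetric] w'_def[symmetric] h_def[symmetric] by linarith
    have "\<bar>h\<bar> \<le> \<bar>w'\<bar>"
      using saturation_increment_abs_le[OF \<rho>] that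
      by (simp add: h_def w'_def step_reduced(2) in_phase_space_iff)
    then have "(B * h)\<^sup>2 \<le> B\<^sup>2 * w'\<^sup>2"
      by (simp add: power_mult_distrib abs_le_square_iff mult_left_mono)
    moreover have "z\<^sup>2 \<le> 3 * (A * (w' - w))\<^sup>2 + 3 * (B * h)\<^sup>2 + 3 * (C * w')\<^sup>2"
      unfolding z using sum_squares_bound[of "A * (w' - w)" "B * h"]
        sum_squares_bound[of "A * (w' - w)" "C * w'"] sum_squares_bound[of "B * h" "C * w'"]
      by (simp add: power2_eq_square algebra_simps)
    ultimately have "z\<^sup>2 \<le> 3 * (A * (w' - w))\<^sup>2 + 3 * (B\<^sup>2 + C\<^sup>2) * w'\<^sup>2"
      by (simp add: power_mult_distrib algebra_simps)
    then have "z\<^sup>2 / E \<le> (3 * (A * (w' - w))\<^sup>2 + 3 * (B\<^sup>2 + C\<^sup>2) * w'\<^sup>2) / E"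
      using pos by (intro divide_right_mono) auto
    moreover have "energy (gap (f s)) (f s) = A * w'\<^sup>2 + z\<^sup>2 / E"
      using pos by (simp add: energy_def z_def w'_def power2_eq_square)
    moreover have "A * w'\<^sup>2 + (3 * (A * (w' - w))\<^sup>2 + 3 * (B\<^sup>2 + C\<^sup>2) * w'\<^sup>2) / E =
        3 * A / E * (A * (w' - w)\<^sup>2) + L * (2 * C * w'\<^sup>2)"
      using pos by (simp add: L_def field_simps power2_eq_square)
    moreover have "\<dots> \<le> (3 * A / E + L) * energy_drop s"
    proof -
      have "0 \<le> 3 * A / E * (2 * C * w'\<^sup>2)" "0 \<le> L * (A * (w' - w)\<^sup>2)"
        using pos L by auto
      then show ?thesis
        unfolding energy_drop_def w_def[symmetric] w'_def[symmetric] by (simp add: algebra_simps)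
    qed
    ultimately show ?thesis
      by linarith
  qed
  moreover have "3 * A / E + L > 0"
    using pos L by (auto intro: add_pos_pos)
  ultimately show ?thesis
    by blast
qed

text \<open>Each reduced coordinate is controlled by the root of the energy, and the deviations of
  \<open>y\<close> and \<open>p\<close> are linear in the reduced ones.\<close>

lemma dist_equilibrium_le:
  "\<exists>K>0. \<forall>v s. dist s (equilibrium v) \<le> K * sqrt (energy v s)"
proof -
  \<comment> \<open>The deviation in \<open>x\<close> enters through \<open>x\<close> and
    \<open>p\<close>, that of the gap through \<open>p\<close> and \<open>y\<close>, and the
    velocity through \<open>y\<close> alone.\<close>
  define K where "K = 2 / sqrt E + (1 + b1 / b2) / sqrt D + (1 - b1) / b2 / sqrt A"
  have "dist s (equilibrium v) \<le> K * sqrt (energy v s)" for v s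
  proof -
    obtain x y p where s: "s = (x, y, p)" by (cases s) auto
    define X where "X = x - \<kappa> * v"
    define U where "U = gap s - v"
    define w where "w = velocity s"
    have en: "energy v s = A * w\<^sup>2 + E * X\<^sup>2 + D * U\<^sup>2"
      by (simp add: energy_def w_def X_def U_def s)
    have root: "\<bar>t\<bar> \<le> sqrt (energy v s) / sqrt k" if "k > 0" "k * t\<^sup>2 \<le> energy v s" for k t
      using that real_sqrt_le_mono[OF that(2)] by (simp add: real_sqrt_mult field_simps)
    have le: "E * X\<^sup>2 \<le> energy v s" "D * U\<^sup>2 \<le> energy v s" "A * w\<^sup>2 \<le> energy v s"
      using pos by (simp_all add: en)
    have "2 * \<bar>X\<bar> + (1 + b1 / b2) * \<bar>U\<bar> + (1 - b1) / b2 * \<bar>w\<bar> \<le>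
        2 * (sqrt (energy v s) / sqrt E) + (1 + b1 / b2) * (sqrt (energy v s) / sqrt D)
        + (1 - b1) / b2 * (sqrt (energy v s) / sqrt A)"
      using b1 b2 by (intro add_mono mult_left_mono root pos le) auto
    also have "\<dots> = K * sqrt (energy v s)"
      by (simp add: K_def algebra_simps)
    finally have bound: "2 * \<bar>X\<bar> + (1 + b1 / b2) * \<bar>U\<bar> + (1 - b1) / b2 * \<bar>w\<bar> \<le> K * sqrt (energy v s)" .
    have "b2 * y = (1 - b1) * w + b1 * gap s"
      using b1 by (simp add: w_def velocity_def gap_def s)
    then have "y = ((1 - b1) * w + b1 * gap s) / b2"
      using b2 by (simp add: field_simps)
    then have "y - b1 / b2 * v = (1 - b1) / b2 * w + b1 / b2 * U"
      by (simp add: U_def add_divide_distrib diff_divide_distrib algebra_simps)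
    then have "\<bar>y - b1 / b2 * v\<bar> \<le> (1 - b1) / b2 * \<bar>w\<bar> + b1 / b2 * \<bar>U\<bar>"
      using b1 b2 abs_triangle_ineq[of "(1 - b1) / b2 * w" "b1 / b2 * U"] by (simp add: abs_mult)
    moreover have "p - (\<kappa> - 1) * v = X - U"
      by (simp add: X_def U_def gap_def s algebra_simps)
    moreover have "dist s (equilibrium v) \<le> \<bar>X\<bar> + (\<bar>y - b1 / b2 * v\<bar> + \<bar>p - (\<kappa> - 1) * v\<bar>)"
    proof -
      have le: "sqrt (a\<^sup>2 + b\<^sup>2) \<le> a + b" if "a \<ge> 0" "b \<ge> 0" for a b :: real
        using that by (rule sqrt_sum_squares_le_sum)
      have "dist s (equilibrium v) \<le> dist x (\<kappa> * v) + dist (y, p) (b1 / b2 * v, (\<kappa> - 1) * v)"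
        unfolding s equilibrium_def dist_Pair_Pair[of x] by (rule le) auto
      moreover have "dist (y, p) (b1 / b2 * v, (\<kappa> - 1) * v) \<le> dist y (b1 / b2 * v) + dist p ((\<kappa> - 1) * v)"
        unfolding dist_Pair_Pair by (rule le) auto
      ultimately show ?thesis
        by (simp add: dist_real_def X_def)
    qed
    ultimately show ?thesis
      using bound abs_triangle_ineq4[of X U] unfolding distrib_right by linarith
  qed
  moreover have "K > 0"
    using pos b1 b2 unfolding K_def by (intro add_pos_pos divide_pos_pos) auto
  ultimately show ?thesis
    by blast
qed

text \<open>Parameter \<open>0\<close> is admissible for all states, so this yields one bound on the
  total drop of every orbit starting in \<open>S\<close>.\<close>

lemma energy_bounded:
  assumes "S \<subseteq> phase_space \<rho>" "bounded S"
  shows "\<exists>M>0. \<forall>s\<in>S. energy 0 s \<le> M"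
proof -
  obtain R where R: "\<And>s. s \<in> S \<Longrightarrow> norm s \<le> R"
    using assms(2) bounded_iff by blast
  define M where "M = A * ((b2 * R + b1 * \<rho>) / (1 - b1))\<^sup>2 + E * R\<^sup>2 + D * \<rho>\<^sup>2"
  have "energy 0 s \<le> M" if "s \<in> S" for s
  proof -
    obtain x y p where s: "s = (x, y, p)" by (cases s) auto
    have "\<bar>x\<bar> \<le> R" "norm (y, p) \<le> R"
      using R[OF that] norm_fst_le[of x "(y, p)"] norm_snd_le[of "(y, p)" x] by (simp_all add: s)
    then have x: "\<bar>x\<bar> \<le> \<bar>R\<bar>" and y: "\<bar>y\<bar> \<le> R"
      using norm_fst_le[of y p] by auto
    have u: "\<bar>x - p\<bar> \<le> \<rho>"
      using that assms(1) by (auto simp: s phase_space_def)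
    have "\<bar>b2 * y - b1 * (x - p)\<bar> \<le> b2 * \<bar>y\<bar> + b1 * \<bar>x - p\<bar>"
      using abs_triangle_ineq4[of "b2 * y" "b1 * (x - p)"] b1 b2 by (simp add: abs_mult)
    also have "\<dots> \<le> b2 * R + b1 * \<rho>"
      using b1 b2 y u by (intro add_mono mult_left_mono) auto
    finally have "\<bar>velocity s\<bar> \<le> (b2 * R + b1 * \<rho>) / (1 - b1)"
      using b1 by (simp add: velocity_def s divide_right_mono)
    then have "(velocity s)\<^sup>2 \<le> ((b2 * R + b1 * \<rho>) / (1 - b1))\<^sup>2"
      by (metis abs_le_square_iff abs_of_nonneg abs_ge_zero order_trans)
    moreover have "x\<^sup>2 \<le> R\<^sup>2" "(x - p)\<^sup>2 \<le> \<rho>\<^sup>2"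
      using x u \<rho> by (simp_all add: abs_le_square_iff[symmetric])
    ultimately show ?thesis
      using pos unfolding energy_def M_def by (auto simp: s gap_def intro!: add_mono mult_left_mono)
  qed
  then show ?thesis
    by (intro exI[of _ "max M 1"]) (auto simp: le_max_iff_disj)
qed

section \<open>Uniform attraction and convergence\<close>

text \<open>The order of quantifiers serves two purposes: \<open>N\<close> is common to all of
  \<open>S\<close>, as attraction requires, and \<open>e\<close> is common to all late times, as
  convergence requires.\<close>

lemma uniformly_eventually_near_equilibrium:
  assumes "S \<subseteq> phase_space \<rho>" "bounded S" "\<epsilon> > 0"
  shows "\<exists>N. \<forall>s\<in>S. \<exists>e\<in>equilibrium_segment a1 a2 b1 b2 c1 c2 \<rho>. \<forall>n\<ge>N. dist ((f ^^ n) s) e < \<epsilon>"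
proof -
  obtain M where M: "M > 0" "\<And>s. s \<in> S \<Longrightarrow> energy 0 s \<le> M"
    using energy_bounded[OF assms(1,2)] by blast
  obtain K where K: "K > 0" "\<And>s. s \<in> phase_space \<rho> \<Longrightarrow> energy (gap (f s)) (f s) \<le> K * energy_drop s"
    using energy_gap_le_drop by blast
  obtain L where L: "L > 0" "\<And>v s. dist s (equilibrium v) \<le> L * sqrt (energy v s)"
    using dist_equilibrium_le by blast
  \<comment> \<open>Some drop among the first \<open>N\<close> is at most \<open>M / N\<close>; this
    \<open>N\<close> makes the energy after that step less than
    \<open>(\<epsilon> / L)^2\<close>.\<close>
  obtain N :: nat where N: "N > 0" "K * M / (\<epsilon> / L)\<^sup>2 < N"
    using reals_Archimedean2[of "K * M / (\<epsilon> / L)\<^sup>2"] K M L assms(3)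
    by (metis divide_pos_pos mult_pos_pos of_nat_0_less_iff order_less_trans zero_less_power)
  then have small: "K * (M / N) < (\<epsilon> / L)\<^sup>2"
    using L assms(3) by (simp add: field_simps)
  have "\<exists>e\<in>equilibrium_segment a1 a2 b1 b2 c1 c2 \<rho>. \<forall>n\<ge>N. dist ((f ^^ n) s) e < \<epsilon>" if "s \<in> S" for s
  proof -
    have s: "s \<in> phase_space \<rho>"
      using that assms(1) by blast
    have "(\<Sum>k<N. energy_drop ((f ^^ k) s)) \<le> M"
      using sum_energy_drop_le[OF s, of 0 N] M(2)[OF that] \<rho> by simp
    then obtain k where k: "k < N" "energy_drop ((f ^^ k) s) \<le> M / N"
      using sum_le_imp_exists_small_term N(1) by blast
    define v where "v = gap ((f ^^ Suc k) s)"
    have v: "\<bar>v\<bar> \<le> \<rho>"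
      using orbit_in_phase_space[OF s, of "Suc k"] by (simp add: v_def in_phase_space_iff)
    have "energy v ((f ^^ Suc k) s) \<le> K * energy_drop ((f ^^ k) s)"
      using K(2)[OF orbit_in_phase_space[OF s, of k]] by (simp add: v_def)
    also have "\<dots> \<le> K * (M / N)"
      using k K by (intro mult_left_mono) auto
    also note small
    finally have en: "energy v ((f ^^ Suc k) s) < (\<epsilon> / L)\<^sup>2" .
    have "dist ((f ^^ n) s) (equilibrium v) < \<epsilon>" if "n \<ge> N" for n
    proof -
      \<comment> \<open>From \<open>k < N\<close> follows \<open>Suc k \<le> N\<close>, so
        monotonicity reaches all \<open>n \<ge> N\<close>.\<close>
      have "energy v ((f ^^ n) s) < (\<epsilon> / L)\<^sup>2"
        using energy_antimono[OF s v, of "Suc k" n] en k that by linarith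
      then have "sqrt (energy v ((f ^^ n) s)) < \<epsilon> / L"
        using L assms(3) by (intro real_less_lsqrt) auto
      then have "L * sqrt (energy v ((f ^^ n) s)) < \<epsilon>"
        using L by (simp add: field_simps)
      then show ?thesis
        using L(2)[of "(f ^^ n) s" v] by linarith
    qed
    then show ?thesis
      using equilibrium_in_segment[OF v] by blast
  qed
  then show ?thesis
    by blast
qed

lemma segment_eq_equilibria:
  "equilibrium_segment a1 a2 b1 b2 c1 c2 \<rho> = equilibria a1 a2 b1 b2 c1 c2 \<rho>"
  using a2 b2 c1 \<rho> by (intro equilibria_eq_segment[symmetric]) auto

lemma segment_global_attractor:
  "global_attractor f (phase_space \<rho>) (equilibrium_segment a1 a2 b1 b2 c1 c2 \<rho>)"
proof -
  let ?A = "equilibrium_segment a1 a2 b1 b2 c1 c2 \<rho>"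
  have fixed: "f s = s" if "s \<in> ?A" for s
    using that unfolding segment_eq_equilibria by (simp add: equilibria_def map_eq_iff)
  have "?A \<subseteq> phase_space \<rho>"
    unfolding segment_eq_equilibria by (auto simp: equilibria_def)
  moreover have "equilibrium 0 \<in> ?A"
    using \<rho> by (intro equilibrium_in_segment) simp
  moreover have "f ` ?A = ?A"
    using fixed by force
  moreover have "\<exists>N. \<forall>n\<ge>N. \<forall>s\<in>S. \<exists>a\<in>?A. dist ((f ^^ n) s) a < \<epsilon>"
    if "S \<subseteq> phase_space \<rho>" "bounded S" "\<epsilon> > 0" for S \<epsilon>
    using uniformly_eventually_near_equilibrium[OF that] by meson
  moreover have "?A \<noteq> {}" "f ` phase_space \<rho> \<subseteq> phase_space \<rho>"
    using \<open>equilibrium 0 \<in> ?A\<close> map_in_phase_space by auto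
  ultimately show ?thesis
    unfolding global_attractor_def by (intro conjI allI impI compact_equilibrium_segment) simp_all
qed

lemma trajectory_converges:
  assumes "is_trajectory a1 a2 b1 b2 c1 c2 \<rho> s"
  shows "\<exists>e\<in>equilibrium_segment a1 a2 b1 b2 c1 c2 \<rho>. s \<longlonglongrightarrow> e"
proof (rule convergent_if_eventually_near)
  have "s 0 \<in> phase_space \<rho> \<and> (\<forall>t. s t = (f ^^ t) (s 0))"
    using a1 b1 a2 b2 c1 c2 \<rho> by (intro is_trajectory_iff_orbit[THEN iffD1] assms) auto
  then have s0: "{s 0} \<subseteq> phase_space \<rho>" and orbit: "\<And>t. (f ^^ t) (s 0) = s t"
    by (blast, metis)
  \<comment> \<open>The uniform statement is applied to the bounded set
    \<open>{s 0}\<close>.\<close>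
  show "\<exists>N. \<exists>e\<in>equilibrium_segment a1 a2 b1 b2 c1 c2 \<rho>. \<forall>n\<ge>N. dist (s n) e < \<epsilon>" if "\<epsilon> > 0" for \<epsilon>
    using uniformly_eventually_near_equilibrium[OF s0 _ that] by (simp add: orbit)
qed (intro compact_imp_closed compact_equilibrium_segment)

end

theorem theorem3p1:
  fixes a1 a2 b1 b2 c1 c2 \<rho> :: real
  assumes "0 \<le> a1" "a1 < 1" "0 < b1" "b1 < 1"
    and "a2 > 0" "b2 > 0" "c1 > 0" "c2 > 0" "\<rho> > 0"
  shows "(c1 \<noteq> 1 \<longrightarrow>
            equilibria a1 a2 b1 b2 c1 c2 \<rho> = equilibrium_segment a1 a2 b1 b2 c1 c2 \<rho>) \<and>
         (c1 > 1 \<longrightarrow>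
            global_attractor (system_map a1 a2 b1 b2 c1 c2 \<rho>) (phase_space \<rho>)
              (equilibrium_segment a1 a2 b1 b2 c1 c2 \<rho>) \<and>
            (\<forall>s. is_trajectory a1 a2 b1 b2 c1 c2 \<rho> s \<longrightarrow>
               (\<exists>e \<in> equilibrium_segment a1 a2 b1 b2 c1 c2 \<rho>. s \<longlonglongrightarrow> e)))"
proof (intro conjI impI allI)
  show "equilibria a1 a2 b1 b2 c1 c2 \<rho> = equilibrium_segment a1 a2 b1 b2 c1 c2 \<rho>" if "c1 \<noteq> 1"
    using assms that by (intro equilibria_eq_segment)
next
  assume "c1 > 1"
  then interpret piecewise_linear_system a1 a2 b1 b2 c1 c2 \<rho>
    using assms by unfold_locales
  show "global_attractor f (phase_space \<rho>) (equilibrium_segment a1 a2 b1 b2 c1 c2 \<rho>)"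
    by (rule segment_global_attractor)
  show "\<exists>e\<in>equilibrium_segment a1 a2 b1 b2 c1 c2 \<rho>. s \<longlonglongrightarrow> e"
    if "is_trajectory a1 a2 b1 b2 c1 c2 \<rho> s" for s
    using that by (rule trajectory_converges)
qed

end
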